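(* Given a graph $G=(V,E)$ and a total order $\prec$ on $V$, a vector $x \in \{0,1\}^{|\overline{E}|}$ is the incidence vector of a proper coloring of $G$ if and only if $x$ is the incidence vector of a stable set in $\mathcal{R}^{\prec}_{G}$. That is, $$P^{Co}_{\prec}(G) = STAB(\mathcal{R}^{\prec}_{G}).$$
   Context: Graphs are finite and simple. For $G=(V,E)$, $\overline{G}=(V,\overline{E})$ is its complement. Given a total order $\prec$ on $V$ and $u\in V$, let $\bar N^{L}(u)=\{v : uv\in\overline{E},\ v\prec u\}$ and $\bar N^{U}(u)=\{v : uv\in\overline{E},\ u\prec v\}$. Vectors $x\in\mathbb{R}^{|\overline{E}|}$ have one coordinate $x_{uv}$ for each $uv\in\overline{E}$ with $u\prec v$. The representatives constraints are: for every $u\in V$ and every clique $K$ of $G$ with $K\subseteq \bar N^{U}(u)$ (with $K=\emptyset$ allowed), $$\sum_{v\in \bar N^{L}(u)} x_{vu}+\sum_{v\in K}x_{uv}\le 1.$$ A vector $x\in\{0,1\}^{|\overline{E}|}$ encodes (is the incidence vector of) a proper coloring of $G$ if it satisfies all representatives constraints; here $x_{uv}=1$ means that $u$ is the representative (the $\prec$-smallest vertex) of the color class containing $v$. $P^{Co}_{\prec}(G)$ is the convex hull of all $x\in\{0,1\}^{|\overline{E}|}$ satisfying all representatives constraints. The graph $\mathcal{R}^{\prec}_{G}$ has vertex set $\overline{E}$, and two distinct elements of $\overline{E}$ are adjacent in $\mathcal{R}^{\prec}_{G}$ if and only if their variables both appear (with nonzero coefficient) in a common representatives constraint. For a graph $H$,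 $STAB(H)$ is the convex hull of the characteristic vectors of the stable sets (sets of pairwise non-adjacent vertices) of $H$. *)

theory Defs
  imports "HOL-Analysis.Convex" "HOL-Analysis.Finite_Function_Topology" "HOL-Library.Ramsey"
begin

text \<open>
  A finite simple graph is a pair \<open>(V, E)\<close> with \<open>finite V\<close> and \<open>E \<subseteq> [V]\<^bsup>2\<^esup>\<close>.
  A total order on \<open>V\<close> is a relation \<open>r\<close> with \<^const>\<open>strict_linear_order_on\<close>;
  \<open>(u, v) \<in> r\<close> means that \<open>u\<close> strictly precedes \<open>v\<close>.
  Elements of the real vector space with one coordinate for each element of a finite set \<open>I\<close>
  are the \<open>x :: 'b \<Rightarrow>\<^sub>0 real\<close> with \<open>Poly_Mapping.keys x \<subseteq> I\<close>.
\<close>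

definition complement_edges :: "'a set \<Rightarrow> 'a set set \<Rightarrow> 'a set set" where
  "complement_edges V E = [V]\<^bsup>2\<^esup> - E"

definition lower_nonnbrs :: "'a set \<Rightarrow> 'a set set \<Rightarrow> 'a rel \<Rightarrow> 'a \<Rightarrow> 'a set" where
  "lower_nonnbrs V E r u = {v. {u, v} \<in> complement_edges V E \<and> (v, u) \<in> r}"

definition upper_nonnbrs :: "'a set \<Rightarrow> 'a set set \<Rightarrow> 'a rel \<Rightarrow> 'a \<Rightarrow> 'a set" where
  "upper_nonnbrs V E r u = {v. {u, v} \<in> complement_edges V E \<and> (u, v) \<in> r}"

definition clique_in :: "'a set set \<Rightarrow> 'a set \<Rightarrow> bool" where
  "clique_in E K \<longleftrightarrow> pairwise (\<lambda>u v. {u, v} \<in> E) K"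

definition stable_in :: "'a set set \<Rightarrow> 'a set \<Rightarrow> bool" where
  "stable_in E S \<longleftrightarrow> pairwise (\<lambda>u v. {u, v} \<notin> E) S"

definition char_vec :: "'b set \<Rightarrow> ('b \<Rightarrow>\<^sub>0 real)" where
  "char_vec S = (\<Sum>e\<in>S. Poly_Mapping.single e 1)"

definition STAB :: "'b set \<Rightarrow> 'b set set \<Rightarrow> ('b \<Rightarrow>\<^sub>0 real) set" where
  "STAB W F = convex hull {char_vec S | S. S \<subseteq> W \<and> stable_in F S}"

definition zero_one_vectors :: "'b set \<Rightarrow> ('b \<Rightarrow>\<^sub>0 real) set" where
  "zero_one_vectors I =
     {x. Poly_Mapping.keys x \<subseteq> I \<and> (\<forall>e\<in>I. Poly_Mapping.lookup x e \<in> {0, 1})}"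

text \<open>The pairs \<open>(u, K)\<close> indexing the representatives constraints.\<close>

definition rep_index :: "'a set \<Rightarrow> 'a set set \<Rightarrow> 'a rel \<Rightarrow> ('a \<times> 'a set) set" where
  "rep_index V E r = {(u, K). u \<in> V \<and> K \<subseteq> upper_nonnbrs V E r u \<and> clique_in E K}"

text \<open>
  The left-hand side of a representatives constraint. The variable of a non-edge with
  end vertices \<open>u\<close> and \<open>v\<close>, whichever precedes the other, is the coordinate \<open>{u, v}\<close>.
\<close>

definition rep_lhs ::
  "'a set \<Rightarrow> 'a set set \<Rightarrow> 'a rel \<Rightarrow> 'a \<Rightarrow> 'a set \<Rightarrow> ('a set \<Rightarrow>\<^sub>0 real) \<Rightarrow> real" where
  "rep_lhs V E r u K x =
     (\<Sum>v\<in>lower_nonnbrs V E r u. Poly_Mapping.lookup x {v, u})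
     + (\<Sum>v\<in>K. Poly_Mapping.lookup x {u, v})"

definition satisfies_rep_constraints ::
  "'a set \<Rightarrow> 'a set set \<Rightarrow> 'a rel \<Rightarrow> ('a set \<Rightarrow>\<^sub>0 real) \<Rightarrow> bool" where
  "satisfies_rep_constraints V E r x \<longleftrightarrow> (\<forall>(u, K)\<in>rep_index V E r. rep_lhs V E r u K x \<le> 1)"

definition encodes_coloring ::
  "'a set \<Rightarrow> 'a set set \<Rightarrow> 'a rel \<Rightarrow> ('a set \<Rightarrow>\<^sub>0 real) \<Rightarrow> bool" where
  "encodes_coloring V E r x \<longleftrightarrow>
     x \<in> zero_one_vectors (complement_edges V E) \<and> satisfies_rep_constraints V E r x"

definition P_Co :: "'a set \<Rightarrow> 'a set set \<Rightarrow> 'a rel \<Rightarrow> ('a set \<Rightarrow>\<^sub>0 real) set" where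
  "P_Co V E r = convex hull {x. encodes_coloring V E r x}"

text \<open>
  The coefficient of a variable in a linear form is the value of the form at the
  corresponding unit vector.
\<close>

definition rep_coeff ::
  "'a set \<Rightarrow> 'a set set \<Rightarrow> 'a rel \<Rightarrow> 'a \<Rightarrow> 'a set \<Rightarrow> 'a set \<Rightarrow> real" where
  "rep_coeff V E r u K e = rep_lhs V E r u K (Poly_Mapping.single e 1)"

definition rep_graph_edges :: "'a set \<Rightarrow> 'a set set \<Rightarrow> 'a rel \<Rightarrow> 'a set set set" where
  "rep_graph_edges V E r =
     {{e, f} | e f. e \<in> complement_edges V E \<and> f \<in> complement_edges V E \<and> e \<noteq> f \<and>
        (\<exists>(u, K)\<in>rep_index V E r. rep_coeff V E r u K e \<noteq> 0 \<and> rep_coeff V E r u K f \<noteq> 0)}"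

lemma sum_zero_one_le_1:
  fixes f :: "'b \<Rightarrow> real"
  assumes "finite A" and "\<And>a. a \<in> A \<Longrightarrow> f a \<in> {0, 1}"
    and "\<And>a b. a \<in> A \<Longrightarrow> b \<in> A \<Longrightarrow> f a = 1 \<Longrightarrow> f b = 1 \<Longrightarrow> a = b"
  shows "sum f A \<le> 1"
proof (cases "\<exists>a\<in>A. f a = 1")
  case True
  then obtain a where a: "a \<in> A" "f a = 1" by blast
  have "sum f (A - {a}) = 0"
    using assms a by (intro sum.neutral) blast
  then show ?thesis using a sum.remove[OF assms(1) a(1), of f] by simp
next
  case False
  then have "sum f A = 0" using assms(2) by (intro sum.neutral) blast
  then show ?thesis by simp
qed

text \<open>
  Satisfying the representatives constraints does characterise the incidence vectors of proper
  colorings \<open>c\<close>: the coordinate \<open>{u, v}\<close>, with \<open>u\<close> preceding \<open>v\<close>, is \<open>1\<close> exactly if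
  \<open>u\<close> is the first vertex of the color class containing \<open>v\<close>.
\<close>

lemma satisfies_rep_constraints_iff_coloring:
  fixes V :: "'a set"
  assumes fin: "finite V" and "E \<subseteq> [V]\<^bsup>2\<^esup>" and ord: "strict_linear_order_on V r"
    and x: "x \<in> zero_one_vectors (complement_edges V E)"
  shows "satisfies_rep_constraints V E r x \<longleftrightarrow>
    (\<exists>c :: 'a \<Rightarrow> 'a. (\<forall>u v. {u, v} \<in> E \<longrightarrow> c u \<noteq> c v) \<and>
      (\<forall>u v. {u, v} \<in> complement_edges V E \<and> (u, v) \<in> r \<longrightarrow>
        Poly_Mapping.lookup x {u, v} =
          (if c u = c v \<and> (\<forall>w\<in>V. c w = c v \<and> w \<noteq> u \<longrightarrow> (u, w) \<in> r) then 1 else 0)))"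
    (is "?L \<longleftrightarrow> (\<exists>c. ?P c \<and> ?Q c)")
proof -
  define X where "X u v \<longleftrightarrow> {u, v} \<in> complement_edges V E \<and> (u, v) \<in> r \<and>
    Poly_Mapping.lookup x {u, v} = 1" for u v
  have tr: "(a, b) \<in> r \<Longrightarrow> (b, c) \<in> r \<Longrightarrow> (a, c) \<in> r" for a b c
    using ord by (auto simp: strict_linear_order_on_def trans_def)
  have irr: "(a, a) \<notin> r" for a
    using ord by (auto simp: strict_linear_order_on_def irrefl_def)
  have tot: "a \<in> V \<Longrightarrow> b \<in> V \<Longrightarrow> a \<noteq> b \<Longrightarrow> (a, b) \<in> r \<or> (b, a) \<in> r" for a b
    using ord by (auto simp: strict_linear_order_on_def total_on_def)
  have cmpl: "{a, b} \<in> complement_edges V E \<longleftrightarrow> a \<in> V \<and> b \<in> V \<and> a \<noteq> b \<and> {a, b} \<notin> E" for a b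
    by (auto simp: complement_edges_def nsets_def card_2_iff doubleton_eq_iff)
  have EV: "{a, b} \<in> E \<Longrightarrow> a \<in> V \<and> b \<in> V \<and> a \<noteq> b" for a b
    using assms(2) by (auto simp: nsets_def card_2_iff doubleton_eq_iff)
  have zo: "Poly_Mapping.lookup x {u, v} = (if X u v then 1 else 0)"
    if "{u, v} \<in> complement_edges V E" "(u, v) \<in> r" for u v
    using x that by (auto simp: zero_one_vectors_def X_def)
  have XV: "X u v \<Longrightarrow> u \<in> V \<and> v \<in> V \<and> (u, v) \<in> r \<and> {u, v} \<notin> E" for u v
    by (auto simp: X_def cmpl)
  have finN: "finite (lower_nonnbrs V E r u)" "finite (upper_nonnbrs V E r u)" for u
    using fin by (auto simp: lower_nonnbrs_def upper_nonnbrs_def cmpl intro: finite_subset[of _ V])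
  have lhs: "rep_lhs V E r u K x =
      (\<Sum>v\<in>lower_nonnbrs V E r u. if X v u then 1 else 0) + (\<Sum>v\<in>K. if X u v then 1 else 0)"
    if "K \<subseteq> upper_nonnbrs V E r u" for u K
  proof -
    have "(\<Sum>v\<in>lower_nonnbrs V E r u. Poly_Mapping.lookup x {v, u}) =
        (\<Sum>v\<in>lower_nonnbrs V E r u. if X v u then 1 else 0)"
      by (rule sum.cong) (simp_all add: lower_nonnbrs_def insert_commute zo)
    moreover have "(\<Sum>v\<in>K. Poly_Mapping.lookup x {u, v}) = (\<Sum>v\<in>K. if X u v then 1 else 0)"
      using that by (intro sum.cong refl zo) (auto simp: upper_nonnbrs_def)
    ultimately show ?thesis by (simp add: rep_lhs_def)
  qed
  have "?L \<longleftrightarrow> (\<forall>u v w. X v u \<and> X w u \<longrightarrow> v = w) \<and> (\<forall>u v w. \<not> (X u v \<and> X v w)) \<and>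
      (\<forall>u v w. X u v \<and> X u w \<longrightarrow> {v, w} \<notin> E)"  (is "_ \<longleftrightarrow> ?M1 \<and> ?M2 \<and> ?M3")
  proof (intro iffI conjI allI impI notI)
    fix u v w assume L: ?L and "X v u \<and> X w u"
    then have X: "X v u" "X w u" by auto
    have "({}:: 'a set) \<subseteq> upper_nonnbrs V E r u" "(u, {}) \<in> rep_index V E r"
      using XV[OF X(1)] by (auto simp: rep_index_def clique_in_def)
    then have "rep_lhs V E r u {} x \<le> 1" using L by (auto simp: satisfies_rep_constraints_def)
    then have le: "(\<Sum>v\<in>lower_nonnbrs V E r u. if X v u then 1 else (0::real)) \<le> 1"
      by (simp add: lhs)
    show "v = w"
    proof (rule ccontr)
      assume "v \<noteq> w"
      have "(\<Sum>v\<in>{v, w}. if X v u then 1 else (0::real))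
          \<le> (\<Sum>v\<in>lower_nonnbrs V E r u. if X v u then 1 else 0)"
        using X by (intro sum_mono2 finN) (auto simp: lower_nonnbrs_def X_def insert_commute)
      with X \<open>v \<noteq> w\<close> le show False by simp
    qed
  next
    fix u v w assume L: ?L and "X u v \<and> X v w"
    then have X: "X u v" "X v w" by auto
    have K: "{w} \<subseteq> upper_nonnbrs V E r v" "(v, {w}) \<in> rep_index V E r"
      using X XV[OF X(1)] by (auto simp: rep_index_def clique_in_def upper_nonnbrs_def X_def)
    then have "rep_lhs V E r v {w} x \<le> 1" using L by (auto simp: satisfies_rep_constraints_def)
    then have le: "(\<Sum>a\<in>lower_nonnbrs V E r v. if X a v then 1 else (0::real)) \<le> 0"
      using K X by (simp add: lhs)
    have "(\<Sum>a\<in>{u}. if X a v then 1 else (0::real))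
          \<le> (\<Sum>a\<in>lower_nonnbrs V E r v. if X a v then 1 else 0)"
      using X by (intro sum_mono2 finN) (auto simp: lower_nonnbrs_def X_def insert_commute)
    with X le show False by simp
  next
    fix u v w assume L: ?L and "X u v \<and> X u w" and e: "{v, w} \<in> E"
    then have X: "X u v" "X u w" by auto
    have ne: "v \<noteq> w" using EV[OF e] by auto
    have K: "{v, w} \<subseteq> upper_nonnbrs V E r u" "(u, {v, w}) \<in> rep_index V E r"
      using X e XV[OF X(1)]
      by (auto simp: rep_index_def clique_in_def upper_nonnbrs_def X_def pairwise_def insert_commute)
    then have "rep_lhs V E r u {v, w} x \<le> 1" using L by (auto simp: satisfies_rep_constraints_def)
    then have le: "(\<Sum>a\<in>lower_nonnbrs V E r u. if X a u then 1 else (0::real)) + 2 \<le> 1"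
      using K X ne by (simp add: lhs)
    have "(\<Sum>a\<in>lower_nonnbrs V E r u. if X a u then 1 else (0::real)) \<ge> 0"
      by (rule sum_nonneg) auto
    with le show False by simp
  next
    assume M: "?M1 \<and> ?M2 \<and> ?M3"
    have "rep_lhs V E r u K x \<le> 1"
      if K: "K \<subseteq> upper_nonnbrs V E r u" "clique_in E K" for u K
    proof (cases "\<exists>v. X v u")
      case True
      then have "(\<Sum>v\<in>K. if X u v then 1 else (0::real)) = 0"
        using M by (intro sum.neutral) metis
      moreover have "(\<Sum>v\<in>lower_nonnbrs V E r u. if X v u then 1 else (0::real)) \<le> 1"
        using M finN by (intro sum_zero_one_le_1) (auto split: if_splits)
      ultimately show ?thesis using lhs[OF K(1)] by simp
    next
      case False
      then have "(\<Sum>v\<in>lower_nonnbrs V E r u. if X v u then 1 else (0::real)) = 0"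
        by (intro sum.neutral) auto
      moreover have "(\<Sum>v\<in>K. if X u v then 1 else (0::real)) \<le> 1"
      proof (rule sum_zero_one_le_1)
        show "finite K" using finN K finite_subset by blast
        show "a = b" if "a \<in> K" "b \<in> K" "(if X u a then 1 else 0) = (1::real)"
          "(if X u b then 1 else 0) = (1::real)" for a b
        proof (rule ccontr)
          assume "a \<noteq> b"
          then have "{a, b} \<in> E" using K(2) that(1,2) by (auto simp: clique_in_def pairwise_def)
          then show False using M that(3,4) by (auto split: if_splits)
        qed
      qed auto
      ultimately show ?thesis using lhs[OF K(1)] by simp
    qed
    then show ?L by (auto simp: satisfies_rep_constraints_def rep_index_def)
  qed
  also have "\<dots> \<longleftrightarrow> (\<exists>c. ?P c \<and> ?Q c)"
  proof
    assume M: "?M1 \<and> ?M2 \<and> ?M3"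
    define c where "c v = (if \<exists>u. X u v then THE u. X u v else v)" for v
    have c1: "c v = u" if "X u v" for u v
      unfolding c_def using M that by (auto intro!: the_equality)
    have c2: "c v = v" if "\<And>u. \<not> X u v" for v
      using that by (auto simp: c_def)
    have cc: "X (c v) v \<or> (c v = v \<and> (\<forall>u. \<not> X u v))" for v
      using c1 c2 by metis
    have "c u \<noteq> c v" if e: "{u, v} \<in> E" for u v
    proof
      assume eq: "c u = c v"
      have "u \<noteq> v" using EV[OF e] by auto
      have e': "{v, u} \<in> E" using e by (simp add: insert_commute)
      show False
        using cc[of u] cc[of v] eq M e e' XV \<open>u \<noteq> v\<close> by metis
    qed
    moreover have "Poly_Mapping.lookup x {u, v} =
          (if c u = c v \<and> (\<forall>w\<in>V. c w = c v \<and> w \<noteq> u \<longrightarrow> (u, w) \<in> r) then 1 else 0)"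
      if uv: "{u, v} \<in> complement_edges V E" "(u, v) \<in> r" for u v
    proof -
      have "X u v \<longleftrightarrow> c u = c v \<and> (\<forall>w\<in>V. c w = c v \<and> w \<noteq> u \<longrightarrow> (u, w) \<in> r)"
      proof
        assume X: "X u v"
        then have "c v = u" "c u = u" using M c1 c2 by metis+
        then show "c u = c v \<and> (\<forall>w\<in>V. c w = c v \<and> w \<noteq> u \<longrightarrow> (u, w) \<in> r)"
          using cc XV by metis
      next
        assume R: "c u = c v \<and> (\<forall>w\<in>V. c w = c v \<and> w \<noteq> u \<longrightarrow> (u, w) \<in> r)"
        have "c u = u"
        proof (rule ccontr)
          assume "c u \<noteq> u"
          then have X: "X (c u) u" using cc by metis
          then have "c (c u) = c u" using M c2 by metis
          then have "(u, c u) \<in> r" using R XV[OF X] \<open>c u \<noteq> u\<close> by metis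
          then show False using XV[OF X] tr irr by metis
        qed
        then show "X u v" using R cc[of v] uv irr by metis
      qed
      then show ?thesis using zo[OF uv] by simp
    qed
    ultimately show "\<exists>c. ?P c \<and> ?Q c" by blast
  next
    assume "\<exists>c. ?P c \<and> ?Q c"
    then obtain c where P: "?P c" and Q: "?Q c" by blast
    have X: "c u = c v \<and> (\<forall>w\<in>V. c w = c v \<and> w \<noteq> u \<longrightarrow> (u, w) \<in> r)" if "X u v" for u v
    proof -
      have "{u, v} \<in> complement_edges V E \<and> (u, v) \<in> r" "Poly_Mapping.lookup x {u, v} = 1"
        using that by (auto simp: X_def)
      then show ?thesis using Q by (metis zero_neq_one)
    qed
    have ?M1 using X XV tr irr by metis
    moreover have ?M2 using X XV tr irr by metis
    moreover have ?M3 using X P by metis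
    ultimately show "?M1 \<and> ?M2 \<and> ?M3" by blast
  qed
  finally show ?thesis .
qed

end

theory Submission
  imports Defs
begin

text \<open>
  Every variable occurs in a representatives constraint with coefficient \<open>0\<close> or \<open>1\<close>: once \<open>u\<close> is
  fixed, the non-edge \<open>{u, v}\<close> determines \<open>v\<close>, and \<open>v\<close> cannot both precede and follow \<open>u\<close>. So
  each constraint says that the variables in its support sum to at most \<open>1\<close>
  (\<open>rep_lhs_eq_sum_support\<close>). For a 0/1 vector this means that the
  support contains at most one of its nonzero coordinates
  (\<open>zero_one_sum_le_1_iff\<close>), that is, no two nonzero coordinates share a constraint. Sharing a
  constraint is adjacency in the graph of the theorem, so the condition is that the nonzero
  coordinates form a stable set. A 0/1 vector is the characteristic vector of its set of nonzero
  coordinates, so the generators of the two polytopes coincide.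
\<close>

lemma lookup_char_vec:
  assumes "finite S"
  shows "Poly_Mapping.lookup (char_vec S) e = (if e \<in> S then 1 else 0)"
  using assms by (simp add: char_vec_def lookup_sum lookup_single when_def)

lemma keys_char_vec:
  assumes "finite S"
  shows "Poly_Mapping.keys (char_vec S) = S"
  using assms by (auto simp: in_keys_iff lookup_char_vec split: if_splits)

lemma char_vec_in_zero_one_vectors:
  assumes "finite S" and "S \<subseteq> I"
  shows "char_vec S \<in> zero_one_vectors I"
  using assms by (auto simp: zero_one_vectors_def keys_char_vec lookup_char_vec)

lemma zero_one_vector_eq_char_vec_keys:
  assumes "x \<in> zero_one_vectors I"
  shows "x = char_vec (Poly_Mapping.keys x)"
proof (rule poly_mapping_eqI)
  fix e
  show "Poly_Mapping.lookup x e = Poly_Mapping.lookup (char_vec (Poly_Mapping.keys x)) e"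
    using assms by (auto simp: zero_one_vectors_def lookup_char_vec in_keys_iff)
qed

lemma zero_one_sum_le_1_iff:
  assumes "finite A" and "A \<subseteq> I" and x: "x \<in> zero_one_vectors I"
  shows "(\<Sum>e\<in>A. Poly_Mapping.lookup x e) \<le> 1 \<longleftrightarrow>
    (\<forall>e f. e \<in> A \<inter> Poly_Mapping.keys x \<and> f \<in> A \<inter> Poly_Mapping.keys x \<longrightarrow> e = f)"
proof -
  have zo: "Poly_Mapping.lookup x e \<in> {0, 1}" if "e \<in> A" for e
    using that assms(2) x by (auto simp: zero_one_vectors_def)
  have one: "Poly_Mapping.lookup x e = 1 \<longleftrightarrow> e \<in> Poly_Mapping.keys x" if "e \<in> A" for e
    using zo[OF that] by (auto simp: in_keys_iff)
  show ?thesis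
  proof (intro iffI allI impI)
    fix e f
    assume le: "(\<Sum>e\<in>A. Poly_Mapping.lookup x e) \<le> 1"
      and ef: "e \<in> A \<inter> Poly_Mapping.keys x \<and> f \<in> A \<inter> Poly_Mapping.keys x"
    show "e = f"
    proof (rule ccontr)
      assume "e \<noteq> f"
      then have "2 = (\<Sum>g\<in>{e, f}. Poly_Mapping.lookup x g)"
        using ef one[of e] one[of f] \<open>e \<noteq> f\<close> by simp
      also have "\<dots> \<le> (\<Sum>g\<in>A. Poly_Mapping.lookup x g)"
        using ef assms(1) zo by (intro sum_mono2) force+
      finally show False using le by simp
    qed
  next
    assume "\<forall>e f. e \<in> A \<inter> Poly_Mapping.keys x \<and> f \<in> A \<inter> Poly_Mapping.keys x \<longrightarrow> e = f"
    then show "(\<Sum>e\<in>A. Poly_Mapping.lookup x e) \<le> 1"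
      using assms(1) zo one by (intro sum_zero_one_le_1) auto
  qed
qed

definition rep_support :: "'a set \<Rightarrow> 'a set set \<Rightarrow> 'a rel \<Rightarrow> 'a \<Rightarrow> 'a set \<Rightarrow> 'a set set" where
  "rep_support V E r u K = (\<lambda>v. {u, v}) ` (lower_nonnbrs V E r u \<union> K)"

lemma rep_support_subset:
  assumes "K \<subseteq> upper_nonnbrs V E r u"
  shows "rep_support V E r u K \<subseteq> complement_edges V E"
  using assms by (auto simp: rep_support_def lower_nonnbrs_def upper_nonnbrs_def)

lemma finite_complement_edges: "finite V \<Longrightarrow> finite (complement_edges V E)"
  by (simp add: complement_edges_def finite_imp_finite_nsets)

text \<open>
  Both sums of a constraint run over neighbors of \<open>u\<close> in the complement. They merge into one sum
  over distinct coordinates because a strict order has no pair in both directions and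
  \<open>v \<mapsto> {u, v}\<close> is injective.
\<close>

lemma rep_lhs_eq_sum_support:
  assumes fin: "finite V" and ord: "strict_linear_order_on V r"
    and K: "K \<subseteq> upper_nonnbrs V E r u"
  shows "rep_lhs V E r u K x = (\<Sum>e\<in>rep_support V E r u K. Poly_Mapping.lookup x e)"
proof -
  have sub: "lower_nonnbrs V E r u \<subseteq> V" "upper_nonnbrs V E r u \<subseteq> V"
    by (auto simp: lower_nonnbrs_def upper_nonnbrs_def complement_edges_def nsets_def)
  have finL: "finite (lower_nonnbrs V E r u)" and finK: "finite K"
    using fin sub K by (meson finite_subset subset_trans)+
  have disj: "lower_nonnbrs V E r u \<inter> K = {}"
    using ord K
    by (auto simp: lower_nonnbrs_def upper_nonnbrs_def strict_linear_order_on_def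
        irrefl_def dest: transD)
  have inj: "inj_on (\<lambda>v. {u, v}) (lower_nonnbrs V E r u \<union> K)"
    by (auto simp: inj_on_def doubleton_eq_iff)
  show ?thesis
    unfolding rep_lhs_def rep_support_def sum.reindex[OF inj]
    by (simp add: sum.union_disjoint[OF finL finK disj] insert_commute)
qed

lemma rep_coeff_nonzero_iff:
  assumes "finite V" and "strict_linear_order_on V r" and K: "K \<subseteq> upper_nonnbrs V E r u"
  shows "rep_coeff V E r u K e \<noteq> 0 \<longleftrightarrow> e \<in> rep_support V E r u K"
proof -
  have "finite (rep_support V E r u K)"
    using rep_support_subset[OF K] finite_complement_edges[OF assms(1)] by (rule finite_subset)
  then show ?thesis
    by (simp add: rep_coeff_def rep_lhs_eq_sum_support[OF assms] lookup_single when_def)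
qed

lemma rep_graph_adjacent_iff:
  assumes "finite V" and "strict_linear_order_on V r"
  shows "{e, f} \<in> rep_graph_edges V E r \<longleftrightarrow> e \<noteq> f \<and>
    (\<exists>(u, K)\<in>rep_index V E r. e \<in> rep_support V E r u K \<and> f \<in> rep_support V E r u K)"
proof -
  have upper: "K \<subseteq> upper_nonnbrs V E r u" if "(u, K) \<in> rep_index V E r" for u K
    using that by (simp add: rep_index_def)
  have "{e, f} \<in> rep_graph_edges V E r \<longleftrightarrow>
      e \<in> complement_edges V E \<and> f \<in> complement_edges V E \<and> e \<noteq> f \<and>
      (\<exists>(u, K)\<in>rep_index V E r. rep_coeff V E r u K e \<noteq> 0 \<and> rep_coeff V E r u K f \<noteq> 0)"
    unfolding rep_graph_edges_def by (simp add: doubleton_eq_iff) blast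
  then show ?thesis
    using rep_coeff_nonzero_iff[OF assms upper] rep_support_subset[OF upper] by blast
qed

lemma satisfies_rep_constraints_iff_stable_keys:
  assumes fin: "finite V" and ord: "strict_linear_order_on V r"
    and x: "x \<in> zero_one_vectors (complement_edges V E)"
  shows "satisfies_rep_constraints V E r x \<longleftrightarrow>
    stable_in (rep_graph_edges V E r) (Poly_Mapping.keys x)"
proof -
  have "rep_lhs V E r u K x \<le> 1 \<longleftrightarrow>
      (\<forall>e f. e \<in> rep_support V E r u K \<inter> Poly_Mapping.keys x \<and>
        f \<in> rep_support V E r u K \<inter> Poly_Mapping.keys x \<longrightarrow> e = f)"
    if "(u, K) \<in> rep_index V E r" for u K
  proof -
    have K: "K \<subseteq> upper_nonnbrs V E r u" using that by (simp add: rep_index_def)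
    note sub = rep_support_subset[OF K]
    show ?thesis
      unfolding rep_lhs_eq_sum_support[OF fin ord K]
      using finite_subset[OF sub finite_complement_edges[OF fin]] sub x
      by (rule zero_one_sum_le_1_iff)
  qed
  then have "satisfies_rep_constraints V E r x \<longleftrightarrow>
      (\<forall>(u, K)\<in>rep_index V E r. \<forall>e f. e \<in> rep_support V E r u K \<inter> Poly_Mapping.keys x \<and>
        f \<in> rep_support V E r u K \<inter> Poly_Mapping.keys x \<longrightarrow> e = f)"
    unfolding satisfies_rep_constraints_def by (intro ball_cong) auto
  also have "\<dots> \<longleftrightarrow> stable_in (rep_graph_edges V E r) (Poly_Mapping.keys x)"
    unfolding stable_in_def pairwise_def rep_graph_adjacent_iff[OF fin ord]
      Ball_def Bex_def split_paired_All split_paired_Ex prod.case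
    by blast
  finally show ?thesis .
qed

theorem theorem3p1:
  fixes V :: "'a set" and E :: "'a set set" and r :: "'a rel"
  assumes "finite V" and "E \<subseteq> [V]\<^bsup>2\<^esup>" and "strict_linear_order_on V r"
  shows "(\<forall>x \<in> zero_one_vectors (complement_edges V E).
            encodes_coloring V E r x \<longleftrightarrow>
            (\<exists>S. S \<subseteq> complement_edges V E \<and> stable_in (rep_graph_edges V E r) S \<and> x = char_vec S))
         \<and> P_Co V E r = STAB (complement_edges V E) (rep_graph_edges V E r)"
proof -
  let ?I = "complement_edges V E" and ?F = "rep_graph_edges V E r"
  have fin: "finite S" if "S \<subseteq> ?I" for S
    using that finite_complement_edges[OF assms(1)] by (rule finite_subset)
  have iff: "encodes_coloring V E r x \<longleftrightarrow> (\<exists>S. S \<subseteq> ?I \<and> stable_in ?F S \<and> x = char_vec S)"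
    if x: "x \<in> zero_one_vectors ?I" for x
  proof -
    have "encodes_coloring V E r x \<longleftrightarrow> stable_in ?F (Poly_Mapping.keys x)"
      using x satisfies_rep_constraints_iff_stable_keys[OF assms(1,3) x]
      by (simp add: encodes_coloring_def)
    moreover have "Poly_Mapping.keys x \<subseteq> ?I"
      using x by (simp add: zero_one_vectors_def)
    ultimately show ?thesis
      using zero_one_vector_eq_char_vec_keys[OF x] keys_char_vec[OF fin] by metis
  qed
  have "{x. encodes_coloring V E r x} = {char_vec S | S. S \<subseteq> ?I \<and> stable_in ?F S}"
  proof (rule set_eqI)
    fix x
    \<comment> \<open>Members of either set are 0/1 vectors, where the equivalence above applies.\<close>
    have "x \<in> zero_one_vectors ?I" if "encodes_coloring V E r x"
      using that by (simp add: encodes_coloring_def)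
    moreover have "x \<in> zero_one_vectors ?I" if "x = char_vec S" "S \<subseteq> ?I" for S
      using that char_vec_in_zero_one_vectors fin by blast
    ultimately show "x \<in> {x. encodes_coloring V E r x} \<longleftrightarrow>
        x \<in> {char_vec S | S. S \<subseteq> ?I \<and> stable_in ?F S}"
      using iff by blast
  qed
  then show ?thesis
    using iff by (simp add: P_Co_def STAB_def)
qed

end
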